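(* Consider the class of equations $u_t+g(x,u)\,u_x=f(x,u)$, regarded as the system $$u_t+g\,u_x=f,\qquad f_t=g_t=0,$$ in which $u$ is a differential variable on the space $(t,x)$ and $f,g$ are differential variables on the extended space $(t,x,u)$. For a vector field $$Y=\xi(t,x,u)\frac{\partial}{\partial t}+\tau(t,x,u)\frac{\partial}{\partial x}+\varphi(t,x,u)\frac{\partial}{\partial u}+\chi(t,x,u,f,g)\frac{\partial}{\partial f}+\eta(t,x,u,f,g)\frac{\partial}{\partial g},$$ the general solution of the invariance conditions of this system under $Y$ (i.e. the general infinitesimal generator of the continuous group of equivalence transformations of the class) is $$\xi=\xi(t,x,u),\qquad \tau=\tau(x,u),\qquad \varphi=\varphi(x,u),$$ $$\chi=g\,\varphi_x-f\,g\,\xi_x-f\,\xi_t+f\,\varphi_u-f^2\,\xi_u,$$ $$\eta=f\,\tau_u+g\,\tau_x-g\,\xi_t-g^2\,\xi_x-f\,g\,\xi_u.$$ Equivalently, $Y$ is a sum $Y^1_\xi+Y^2_\tau+Y^3_\varphi$ of vector fields of the form $$Y^1_\xi=\xi\,\frac{\partial}{\partial t}-f[g\,\xi_x+\xi_t+f\,\xi_u]\frac{\partial}{\partial f}-g[f\,\xi_u+\xi_t+g\,\xi_x]\frac{\partial}{\partial g},$$ $$Y^2_\tau=\tau\,\frac{\partial}{\partial x}+[g\,\tau_x+f\,\tau_u]\frac{\partial}{\partial g},\qquad Y^3_\varphi=\varphi\,\frac{\partial}{\partial u}+[g\,\varphi_x+f\,\varphi_u]\frac{\partial}{\partial f}.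$$
   Context: Subscripts on functions denote partial derivatives. The functions $f\neq0$, $g\neq0$ are sufficiently smooth nonconstant functions of $x,u$. An equivalence transformation is a non-degenerate change of the variables $t,x,u$ taking any equation of the form $u_t+g(x,u)u_x=f(x,u)$ into an equation of the same form, generally with different $f(x,u)$ and $g(x,u)$. The invariance conditions are $$\tilde Y[u_t+g\,u_x-f]=0,\qquad \tilde Y[f_t]=\tilde Y[g_t]=0$$ on the manifold defined by the system $u_t+g\,u_x=f$, $f_t=g_t=0$, required for all $f,g$ (so the remaining derivatives $u_x,f_x,f_u,g_x,g_u$ are free variables), where $\tilde Y=Y+\varphi^t\partial_{u_t}+\varphi^x\partial_{u_x}+\chi^t\partial_{f_t}+\eta^t\partial_{g_t}$. Here $\varphi^t=D_t(\varphi-\xi u_t-\tau u_x)+\xi u_{tt}+\tau u_{tx}$ and $\varphi^x=D_x(\varphi-\xi u_t-\tau u_x)+\xi u_{tx}+\tau u_{xx}$ with $D_t,D_x$ the total derivatives on the space $(t,x)$ with dependent variable $u$, and $\chi^t=\widetilde D_t(\chi)-f_t\widetilde D_t(\xi)-f_x\widetilde D_t(\tau)-f_u\widetilde D_t(\varphi)$, $\eta^t=\widetilde D_t(\eta)-g_t\widetilde D_t(\xi)-g_x\widetilde D_t(\tau)-g_u\widetilde D_t(\varphi)$ with $\widetilde D_t=\partial_t+f_t\,\partial_f+g_t\,\partial_g$.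
   Formalization: The conditions also force χ_t=η_t=0, so ξ is not arbitrary (ξ=t², τ=φ=0 fails); what is proved is that the general solution is the stated form together with ξ=ct+a(x,u), c constant. The equivalence of the form with Y¹+Y²+Y³ is kept for arbitrary ξ. *)

theory Defs
  imports "HOL-Analysis.Analysis"
begin

text \<open>A point of the jet space. The coordinates are \<open>t, x, u\<close>, the differential variables \<open>f, g\<close>,
  the derivatives of \<open>u\<close> over the space \<open>(t, x)\<close> up to order two, and the first derivatives of
  \<open>f, g\<close> over the extended space \<open>(t, x, u)\<close>. All of them are independent real coordinates.\<close>

record jet =
  Jt :: real    Jx :: real    Ju :: real
  Jf :: real    Jg :: real
  Jut :: real   Jux :: real   Jutt :: real  Jutx :: real  Juxx :: real
  Jft :: real   Jfx :: real   Jfu :: real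
  Jgt :: real   Jgx :: real   Jgu :: real

definition pd :: "(jet \<Rightarrow> real) \<Rightarrow> ((real \<Rightarrow> real) \<Rightarrow> jet \<Rightarrow> jet) \<Rightarrow> (jet \<Rightarrow> real) \<Rightarrow> jet \<Rightarrow> real"
  where "pd c c_update F p = deriv (\<lambda>s. F (c_update (\<lambda>_. s) p)) (c p)"

text \<open>\<open>Dt\<close> and \<open>Dx\<close> act on functions of \<open>t, x, u, u\<^sub>t, u\<^sub>x\<close>;
  \<open>Dext_t\<close> is the operator \<open>\<partial>\<^sub>t + f\<^sub>t \<partial>\<^sub>f + g\<^sub>t \<partial>\<^sub>g\<close>.\<close>

definition Dt :: "(jet \<Rightarrow> real) \<Rightarrow> jet \<Rightarrow> real" where
  "Dt F p = pd Jt Jt_update F p + Jut p * pd Ju Ju_update F p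
     + Jutt p * pd Jut Jut_update F p + Jutx p * pd Jux Jux_update F p"

definition Dx :: "(jet \<Rightarrow> real) \<Rightarrow> jet \<Rightarrow> real" where
  "Dx F p = pd Jx Jx_update F p + Jux p * pd Ju Ju_update F p
     + Jutx p * pd Jut Jut_update F p + Juxx p * pd Jux Jux_update F p"

definition Dext_t :: "(jet \<Rightarrow> real) \<Rightarrow> jet \<Rightarrow> real" where
  "Dext_t F p = pd Jt Jt_update F p + Jft p * pd Jf Jf_update F p + Jgt p * pd Jg Jg_update F p"

record vfield =
  vxi  :: "real \<Rightarrow> real \<Rightarrow> real \<Rightarrow> real"
  vtau :: "real \<Rightarrow> real \<Rightarrow> real \<Rightarrow> real"
  vphi :: "real \<Rightarrow> real \<Rightarrow> real \<Rightarrow> real"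
  vchi :: "real \<Rightarrow> real \<Rightarrow> real \<Rightarrow> real \<Rightarrow> real \<Rightarrow> real"
  veta :: "real \<Rightarrow> real \<Rightarrow> real \<Rightarrow> real \<Rightarrow> real \<Rightarrow> real"

definition lift3 :: "(real \<Rightarrow> real \<Rightarrow> real \<Rightarrow> real) \<Rightarrow> jet \<Rightarrow> real" where
  "lift3 h p = h (Jt p) (Jx p) (Ju p)"

definition lift5 :: "(real \<Rightarrow> real \<Rightarrow> real \<Rightarrow> real \<Rightarrow> real \<Rightarrow> real) \<Rightarrow> jet \<Rightarrow> real" where
  "lift5 h p = h (Jt p) (Jx p) (Ju p) (Jf p) (Jg p)"

definition phi_t :: "vfield \<Rightarrow> jet \<Rightarrow> real" where
  "phi_t Y p =
     Dt (\<lambda>q. lift3 (vphi Y) q - lift3 (vxi Y) q * Jut q - lift3 (vtau Y) q * Jux q) p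
     + lift3 (vxi Y) p * Jutt p + lift3 (vtau Y) p * Jutx p"

definition phi_x :: "vfield \<Rightarrow> jet \<Rightarrow> real" where
  "phi_x Y p =
     Dx (\<lambda>q. lift3 (vphi Y) q - lift3 (vxi Y) q * Jut q - lift3 (vtau Y) q * Jux q) p
     + lift3 (vxi Y) p * Jutx p + lift3 (vtau Y) p * Juxx p"

definition chi_t :: "vfield \<Rightarrow> jet \<Rightarrow> real" where
  "chi_t Y p = Dext_t (lift5 (vchi Y)) p - Jft p * Dext_t (lift3 (vxi Y)) p
     - Jfx p * Dext_t (lift3 (vtau Y)) p - Jfu p * Dext_t (lift3 (vphi Y)) p"

definition eta_t :: "vfield \<Rightarrow> jet \<Rightarrow> real" where
  "eta_t Y p = Dext_t (lift5 (veta Y)) p - Jgt p * Dext_t (lift3 (vxi Y)) p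
     - Jgx p * Dext_t (lift3 (vtau Y)) p - Jgu p * Dext_t (lift3 (vphi Y)) p"

definition prolong :: "vfield \<Rightarrow> (jet \<Rightarrow> real) \<Rightarrow> jet \<Rightarrow> real" where
  "prolong Y F p =
     lift3 (vxi Y) p * pd Jt Jt_update F p
     + lift3 (vtau Y) p * pd Jx Jx_update F p
     + lift3 (vphi Y) p * pd Ju Ju_update F p
     + lift5 (vchi Y) p * pd Jf Jf_update F p
     + lift5 (veta Y) p * pd Jg Jg_update F p
     + phi_t Y p * pd Jut Jut_update F p
     + phi_x Y p * pd Jux Jux_update F p
     + chi_t Y p * pd Jft Jft_update F p
     + eta_t Y p * pd Jgt Jgt_update F p"

text \<open>Everything is local: \<open>t\<close> ranges over \<open>T\<close>, \<open>(x, u)\<close> over \<open>D\<close> and the values \<open>(f, g)\<close>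
  over \<open>W\<close>. All coordinates of a jet not bound by the three equations below are free, which
  expresses that the invariance is required for all \<open>f, g\<close> and all \<open>u\<close>.\<close>

definition system_manifold :: "real set \<Rightarrow> (real \<times> real) set \<Rightarrow> (real \<times> real) set \<Rightarrow> jet set" where
  "system_manifold T D W =
     {p. Jt p \<in> T \<and> (Jx p, Ju p) \<in> D \<and> (Jf p, Jg p) \<in> W
       \<and> Jut p + Jg p * Jux p = Jf p \<and> Jft p = 0 \<and> Jgt p = 0}"

definition invariance_conditions ::
  "real set \<Rightarrow> (real \<times> real) set \<Rightarrow> (real \<times> real) set \<Rightarrow> vfield \<Rightarrow> bool" where
  "invariance_conditions T D W Y \<longleftrightarrow>
     (\<forall>p \<in> system_manifold T D W.
        prolong Y (\<lambda>q. Jut q + Jg q * Jux q - Jf q) p = 0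
      \<and> prolong Y Jft p = 0 \<and> prolong Y Jgt p = 0)"

definition smooth_vfield ::
  "real set \<Rightarrow> (real \<times> real) set \<Rightarrow> (real \<times> real) set \<Rightarrow> vfield \<Rightarrow> bool" where
  "smooth_vfield T D W Y \<longleftrightarrow>
     (\<lambda>(t, x, u). vxi Y t x u) differentiable_on T \<times> D
   \<and> (\<lambda>(t, x, u). vtau Y t x u) differentiable_on T \<times> D
   \<and> (\<lambda>(t, x, u). vphi Y t x u) differentiable_on T \<times> D
   \<and> (\<lambda>(t, (x, u), (f, g)). vchi Y t x u f g) differentiable_on T \<times> D \<times> W
   \<and> (\<lambda>(t, (x, u), (f, g)). veta Y t x u f g) differentiable_on T \<times> D \<times> W"

definition d_t :: "(real \<Rightarrow> real \<Rightarrow> real \<Rightarrow> real) \<Rightarrow> real \<Rightarrow> real \<Rightarrow> real \<Rightarrow> real" where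
  "d_t h t x u = deriv (\<lambda>s. h s x u) t"

definition d_x :: "(real \<Rightarrow> real \<Rightarrow> real \<Rightarrow> real) \<Rightarrow> real \<Rightarrow> real \<Rightarrow> real \<Rightarrow> real" where
  "d_x h t x u = deriv (\<lambda>s. h t s u) x"

definition d_u :: "(real \<Rightarrow> real \<Rightarrow> real \<Rightarrow> real) \<Rightarrow> real \<Rightarrow> real \<Rightarrow> real \<Rightarrow> real" where
  "d_u h t x u = deriv (\<lambda>s. h t x s) u"

definition time_independent ::
  "real set \<Rightarrow> (real \<times> real) set \<Rightarrow> (real \<Rightarrow> real \<Rightarrow> real \<Rightarrow> real) \<Rightarrow> bool" where
  "time_independent T D h \<longleftrightarrow> (\<exists>k. \<forall>t\<in>T. \<forall>(x, u)\<in>D. h t x u = k x u)"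

definition generator_form ::
  "real set \<Rightarrow> (real \<times> real) set \<Rightarrow> (real \<times> real) set \<Rightarrow> vfield \<Rightarrow> bool" where
  "generator_form T D W Y \<longleftrightarrow>
     time_independent T D (vtau Y) \<and> time_independent T D (vphi Y)
   \<and> (\<forall>t\<in>T. \<forall>(x, u)\<in>D. \<forall>(f, g)\<in>W.
        vchi Y t x u f g =
          g * d_x (vphi Y) t x u - f * g * d_x (vxi Y) t x u - f * d_t (vxi Y) t x u
          + f * d_u (vphi Y) t x u - f\<^sup>2 * d_u (vxi Y) t x u
      \<and> veta Y t x u f g =
          f * d_u (vtau Y) t x u + g * d_x (vtau Y) t x u - g * d_t (vxi Y) t x u
          - g\<^sup>2 * d_x (vxi Y) t x u - f * g * d_u (vxi Y) t x u)"

definition Y1 :: "(real \<Rightarrow> real \<Rightarrow> real \<Rightarrow> real) \<Rightarrow> vfield" where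
  "Y1 \<xi> = \<lparr> vxi = \<xi>, vtau = (\<lambda>t x u. 0), vphi = (\<lambda>t x u. 0),
     vchi = (\<lambda>t x u f g. - f * (g * d_x \<xi> t x u + d_t \<xi> t x u + f * d_u \<xi> t x u)),
     veta = (\<lambda>t x u f g. - g * (f * d_u \<xi> t x u + d_t \<xi> t x u + g * d_x \<xi> t x u)) \<rparr>"

definition Y2 :: "(real \<Rightarrow> real \<Rightarrow> real) \<Rightarrow> vfield" where
  "Y2 \<tau> = \<lparr> vxi = (\<lambda>t x u. 0), vtau = (\<lambda>t x u. \<tau> x u), vphi = (\<lambda>t x u. 0),
     vchi = (\<lambda>t x u f g. 0),
     veta = (\<lambda>t x u f g. g * deriv (\<lambda>s. \<tau> s u) x + f * deriv (\<lambda>s. \<tau> x s) u) \<rparr>"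

definition Y3 :: "(real \<Rightarrow> real \<Rightarrow> real) \<Rightarrow> vfield" where
  "Y3 \<phi> = \<lparr> vxi = (\<lambda>t x u. 0), vtau = (\<lambda>t x u. 0), vphi = (\<lambda>t x u. \<phi> x u),
     vchi = (\<lambda>t x u f g. g * deriv (\<lambda>s. \<phi> s u) x + f * deriv (\<lambda>s. \<phi> x s) u),
     veta = (\<lambda>t x u f g. 0) \<rparr>"

definition vadd :: "vfield \<Rightarrow> vfield \<Rightarrow> vfield"  (infixl "\<oplus>\<^sub>v" 65) where
  "Y \<oplus>\<^sub>v Z = \<lparr> vxi = (\<lambda>t x u. vxi Y t x u + vxi Z t x u),
     vtau = (\<lambda>t x u. vtau Y t x u + vtau Z t x u),
     vphi = (\<lambda>t x u. vphi Y t x u + vphi Z t x u),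
     vchi = (\<lambda>t x u f g. vchi Y t x u f g + vchi Z t x u f g),
     veta = (\<lambda>t x u f g. veta Y t x u f g + veta Z t x u f g) \<rparr>"

definition vfield_eq_on ::
  "real set \<Rightarrow> (real \<times> real) set \<Rightarrow> (real \<times> real) set \<Rightarrow> vfield \<Rightarrow> vfield \<Rightarrow> bool" where
  "vfield_eq_on T D W Y Z \<longleftrightarrow>
     (\<forall>t\<in>T. \<forall>(x, u)\<in>D.
        vxi Y t x u = vxi Z t x u \<and> vtau Y t x u = vtau Z t x u \<and> vphi Y t x u = vphi Z t x u
      \<and> (\<forall>(f, g)\<in>W. vchi Y t x u f g = vchi Z t x u f g \<and> veta Y t x u f g = veta Z t x u f g))"

text \<open>The condition \<open>eta_t = 0\<close>, \<open>chi_t = 0\<close> on the manifold also forces \<open>\<chi>\<close> and \<open>\<eta>\<close>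
  not to depend on \<open>t\<close>, hence \<open>\<xi>\<^sub>t\<^sub>t = \<xi>\<^sub>t\<^sub>x = \<xi>\<^sub>t\<^sub>u = 0\<close>. So \<open>\<xi>\<close> is not an
  arbitrary function of \<open>t, x, u\<close>: \<open>Y1_not_invariant\<close> below is the case \<open>\<xi> = t\<^sup>2\<close>.\<close>

definition affine_in_time ::
  "real set \<Rightarrow> (real \<times> real) set \<Rightarrow> (real \<Rightarrow> real \<Rightarrow> real \<Rightarrow> real) \<Rightarrow> bool" where
  "affine_in_time T D h \<longleftrightarrow> (\<exists>c a. \<forall>t\<in>T. \<forall>(x, u)\<in>D. h t x u = c * t + a x u)"

lemma Y1_not_invariant: "\<not> invariance_conditions UNIV UNIV UNIV (Y1 (\<lambda>t x u. t\<^sup>2))"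
proof
  assume inv: "invariance_conditions UNIV UNIV UNIV (Y1 (\<lambda>t x u. t\<^sup>2))"
  define p where "p = \<lparr> Jt = 0, Jx = 0, Ju = 0, Jf = 1, Jg = 1, Jut = 1, Jux = 0,
    Jutt = 0, Jutx = 0, Juxx = 0, Jft = 0, Jfx = 0, Jfu = 0, Jgt = 0, Jgx = 0, Jgu = 0 \<rparr>"
  have "prolong (Y1 (\<lambda>t x u. t\<^sup>2)) Jft p = 0"
    using inv by (simp add: invariance_conditions_def system_manifold_def p_def)
  moreover have sq: "deriv (\<lambda>s. s\<^sup>2) t = 2 * t" for t :: real
    by (rule DERIV_imp_deriv) (auto intro!: derivative_eq_intros)
  moreover have "deriv (\<lambda>s. - (2 * s)) (0 :: real) = - 2"
    by (rule DERIV_imp_deriv) (auto intro!: derivative_eq_intros)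
  ultimately show False
    by (simp add: prolong_def chi_t_def eta_t_def Dext_t_def pd_def lift3_def lift5_def Y1_def
        d_t_def d_x_def d_u_def p_def)
qed

end

theory Submission
  imports Defs
begin

text \<open>Let \<open>A h = h\<^sub>t + g h\<^sub>x + f h\<^sub>u\<close> be differentiation along the characteristics of
  \<open>u\<^sub>t + g u\<^sub>x = f\<close>, written \<open>along\<close> below. Substituting \<open>u\<^sub>t = f - g u\<^sub>x\<close> into the first
  invariance condition cancels all second derivatives of \<open>u\<close> and leaves
  \<open>(A \<phi> - f A \<xi> - \<chi>) - u\<^sub>x (A \<tau> - g A \<xi> - \<eta>) = 0\<close>. As \<open>u\<^sub>x\<close> is free, both brackets vanish. In
  the other two conditions \<open>f\<^sub>x, f\<^sub>u, g\<^sub>x, g\<^sub>u\<close> are free, so they split into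
  \<open>\<tau>\<^sub>t = \<phi>\<^sub>t = 0\<close> and \<open>\<chi>\<^sub>t = \<eta>\<^sub>t = 0\<close>. These six determining equations are equivalent to
  invariance (\<open>invariance_iff_determining_equations\<close>).

  The first four are the stated form of the generator, once \<open>\<tau>\<^sub>t = \<phi>\<^sub>t = 0\<close> is read as
  independence of \<open>t\<close> on the interval \<open>T\<close>. The last two restrict \<open>\<xi>\<close>: since \<open>A \<phi>\<close> does not
  depend on \<open>t\<close>, neither does \<open>f (\<xi>\<^sub>t + g \<xi>\<^sub>x + f \<xi>\<^sub>u)\<close>, and as \<open>(f, g)\<close> ranges over an open set the
  three partial derivatives of \<open>\<xi>\<close> are each independent of \<open>t\<close>
  (\<open>affine_vanishing_on_open\<close>). Hence \<open>\<xi> = c t + a\<close> with \<open>c\<close> a function of \<open>(x, u)\<close>, and \<open>c\<close> is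
  constant because \<open>\<xi>\<^sub>x\<close> and \<open>\<xi>\<^sub>u\<close> do not depend on \<open>t\<close> and \<open>D\<close> is connected
  (\<open>affine_in_time_if_partials_time_independent\<close>).

  The splitting into \<open>Y\<^sup>1 + Y\<^sup>2 + Y\<^sup>3\<close> follows because each of these fields satisfies
  \<open>\<chi> = A \<phi> - f A \<xi>\<close> and \<open>\<eta> = A \<tau> - g A \<xi>\<close>, identities that are additive in the field.\<close>

section \<open>Partial derivatives\<close>

text \<open>The operators of the jet space differentiate along single coordinates, so this consequence of
  differentiability is the only one that they see.\<close>

definition partially_differentiable ::
  "(real \<Rightarrow> real \<Rightarrow> real \<Rightarrow> real) \<Rightarrow> real \<Rightarrow> real \<Rightarrow> real \<Rightarrow> bool" where
  "partially_differentiable h t x u \<longleftrightarrow>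
     ((\<lambda>s. h s x u) has_real_derivative d_t h t x u) (at t)
   \<and> ((\<lambda>s. h t s u) has_real_derivative d_x h t x u) (at x)
   \<and> ((\<lambda>s. h t x s) has_real_derivative d_u h t x u) (at u)"

lemma has_derivative_deriv_slice:
  fixes F :: "'a :: real_normed_vector \<Rightarrow> real" and c :: "real \<Rightarrow> 'a"
  assumes "F differentiable_on S" "open S" "c a \<in> S" "c differentiable at a"
  shows "((\<lambda>s. F (c s)) has_real_derivative deriv (\<lambda>s. F (c s)) a) (at a)"
proof -
  have "F differentiable at (c a)"
    using assms by (simp add: differentiable_on_eq_differentiable_at)
  then have "(F \<circ> c) differentiable at a"
    using assms(4) by (intro differentiable_chain_at)
  then show ?thesis
    by (simp add: DERIV_deriv_iff_real_differentiable o_def)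
qed

lemma differentiable_on_imp_partially_differentiable:
  assumes "(\<lambda>(t, x, u). h t x u) differentiable_on T \<times> D" "open T" "open D"
    and "t \<in> T" "(x, u) \<in> D"
  shows "partially_differentiable h t x u"
  unfolding partially_differentiable_def d_t_def d_x_def d_u_def
  using has_derivative_deriv_slice[OF assms(1), where c = "\<lambda>s. (s, x, u)" and a = t]
    has_derivative_deriv_slice[OF assms(1), where c = "\<lambda>s. (t, s, u)" and a = x]
    has_derivative_deriv_slice[OF assms(1), where c = "\<lambda>s. (t, x, s)" and a = u]
    assms(2-)
  by (simp add: open_Times)

lemma eventually_slice:
  assumes "open S" "c a \<in> S" "continuous (at a) c"
  shows "eventually (\<lambda>s. c s \<in> S) (nhds a)"
  using assms by (metis continuous_at tendsto_def isCont_def eventually_nhds_conv_at)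

text \<open>Openness of the domain makes the partial derivatives depend only on the values inside it; this
  is what allows fields to be compared on \<open>T \<times> D\<close> alone.\<close>

lemma partial_derivatives_cong:
  assumes "open T" "open D" "t \<in> T" "(x, u) \<in> D"
    and eq: "\<And>s y v. s \<in> T \<Longrightarrow> (y, v) \<in> D \<Longrightarrow> h s y v = k s y v"
  shows "d_t h t x u = d_t k t x u" "d_x h t x u = d_x k t x u" "d_u h t x u = d_u k t x u"
proof -
  have "eventually (\<lambda>s. s \<in> T) (nhds t)"
    using assms by (simp add: eventually_nhds_in_open)
  then show "d_t h t x u = d_t k t x u"
    unfolding d_t_def using assms(4) by (intro deriv_cong_ev) (auto elim!: eventually_mono simp: eq)
  have "eventually (\<lambda>s. (s, u) \<in> D) (nhds x)"
    using assms by (intro eventually_slice) (auto intro!: continuous_intros)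
  then show "d_x h t x u = d_x k t x u"
    unfolding d_x_def using assms(3) by (intro deriv_cong_ev) (auto elim!: eventually_mono simp: eq)
  have "eventually (\<lambda>s. (x, s) \<in> D) (nhds u)"
    using assms by (intro eventually_slice) (auto intro!: continuous_intros)
  then show "d_u h t x u = d_u k t x u"
    unfolding d_u_def using assms(3) by (intro deriv_cong_ev) (auto elim!: eventually_mono simp: eq)
qed

lemma zero_partials_imp_constant:
  fixes k :: "real \<Rightarrow> real \<Rightarrow> real"
  assumes D: "open D" "connected D" and diff: "(\<lambda>(x, u). k x u) differentiable_on D"
    and x: "\<And>x u. (x, u) \<in> D \<Longrightarrow> ((\<lambda>s. k s u) has_real_derivative 0) (at x)"
    and u: "\<And>x u. (x, u) \<in> D \<Longrightarrow> ((\<lambda>s. k x s) has_real_derivative 0) (at u)"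
  shows "\<exists>c. \<forall>(x, u)\<in>D. k x u = c"
proof -
  have "((\<lambda>(x, u). k x u) has_derivative (\<lambda>h. 0)) (at p)" if p: "p \<in> D" for p
  proof -
    obtain a b where ab: "p = (a, b)" by (cases p)
    obtain F where F: "((\<lambda>(x, u). k x u) has_derivative F) (at (a, b))"
      using diff p D ab by (auto simp: differentiable_on_eq_differentiable_at differentiable_def)
    have lin: "linear F" using F by (rule has_derivative_linear)
    have "((\<lambda>s. (\<lambda>(x, u). k x u) (s, b)) has_derivative (\<lambda>h. F (h, 0))) (at a)"
      by (rule has_derivative_compose[where g = "\<lambda>(x, u). k x u" and g' = F])
        (use F in \<open>auto intro!: derivative_eq_intros\<close>)
    moreover have "((\<lambda>s. k s b) has_derivative (\<lambda>h. 0)) (at a)"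
      using x[of a b] p ab by (simp add: has_field_derivative_def lambda_zero)
    ultimately have "(\<lambda>h. F (h, 0)) = (\<lambda>h. 0)"
      by (simp add: has_derivative_unique)
    then have 1: "F (h, 0) = 0" for h by metis
    have "((\<lambda>s. (\<lambda>(x, u). k x u) (a, s)) has_derivative (\<lambda>h. F (0, h))) (at b)"
      by (rule has_derivative_compose[where g = "\<lambda>(x, u). k x u" and g' = F])
        (use F in \<open>auto intro!: derivative_eq_intros\<close>)
    moreover have "((\<lambda>s. k a s) has_derivative (\<lambda>h. 0)) (at b)"
      using u[of a b] p ab by (simp add: has_field_derivative_def lambda_zero)
    ultimately have "(\<lambda>h. F (0, h)) = (\<lambda>h. 0)"
      by (simp add: has_derivative_unique)
    then have 2: "F (0, h) = 0" for h by metis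
    \<comment> \<open>a linear map of the plane that vanishes on both axes is zero\<close>
    have "F (h, h') = 0" for h h'
      using linear_add[OF lin, of "(h, 0)" "(0, h')"] 1 2 by simp
    then have "F = (\<lambda>h. 0)" by auto
    then show ?thesis
      using F ab by simp
  qed
  then have const: "k x u = k y v" if "(x, u) \<in> D" "(y, v) \<in> D" for x u y v
    using has_derivative_zero_unique_connected[OF D _ that, of "\<lambda>(x, u). k x u"] by simp
  show ?thesis
  proof (cases "D = {}")
    case False
    then obtain a b where "(a, b) \<in> D" by auto
    then have "\<forall>(x, u)\<in>D. k x u = k a b" by (blast intro: const)
    then show ?thesis by (rule exI[of _ "k a b"])
  qed simp
qed

section \<open>The determining equations\<close>

definition along ::
  "(real \<Rightarrow> real \<Rightarrow> real \<Rightarrow> real) \<Rightarrow> real \<Rightarrow> real \<Rightarrow> real \<Rightarrow> real \<Rightarrow> real \<Rightarrow> real" where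
  "along h t x u f g = d_t h t x u + g * d_x h t x u + f * d_u h t x u"

text \<open>Partial derivatives of the characteristic \<open>Q = \<phi> - \<xi> u\<^sub>t - \<tau> u\<^sub>x\<close> of the field. The last two are
  responsible for the disappearance of \<open>u\<^sub>t\<^sub>t, u\<^sub>t\<^sub>x, u\<^sub>x\<^sub>x\<close> from the prolongation coefficients.\<close>

lemma pd_characteristic:
  assumes "partially_differentiable (vxi Y) (Jt p) (Jx p) (Ju p)"
    and "partially_differentiable (vtau Y) (Jt p) (Jx p) (Ju p)"
    and "partially_differentiable (vphi Y) (Jt p) (Jx p) (Ju p)"
  defines "Q \<equiv> \<lambda>q. lift3 (vphi Y) q - lift3 (vxi Y) q * Jut q - lift3 (vtau Y) q * Jux q"
    and "C \<equiv> \<lambda>d. d (vphi Y) (Jt p) (Jx p) (Ju p) - d (vxi Y) (Jt p) (Jx p) (Ju p) * Jut p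
      - d (vtau Y) (Jt p) (Jx p) (Ju p) * Jux p"
  shows "pd Jt Jt_update Q p = C d_t" "pd Jx Jx_update Q p = C d_x" "pd Ju Ju_update Q p = C d_u"
    and "pd Jut Jut_update Q p = - lift3 (vxi Y) p" "pd Jux Jux_update Q p = - lift3 (vtau Y) p"
  using assms(1-3) unfolding pd_def lift3_def Q_def C_def partially_differentiable_def
  by (auto intro!: DERIV_imp_deriv derivative_eq_intros)

lemma phi_t_phi_x_eq:
  assumes "partially_differentiable (vxi Y) (Jt p) (Jx p) (Ju p)"
    and "partially_differentiable (vtau Y) (Jt p) (Jx p) (Ju p)"
    and "partially_differentiable (vphi Y) (Jt p) (Jx p) (Ju p)"
  defines "Dt' \<equiv> \<lambda>h. d_t h (Jt p) (Jx p) (Ju p) + Jut p * d_u h (Jt p) (Jx p) (Ju p)"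
    and "Dx' \<equiv> \<lambda>h. d_x h (Jt p) (Jx p) (Ju p) + Jux p * d_u h (Jt p) (Jx p) (Ju p)"
  shows "phi_t Y p = Dt' (vphi Y) - Jut p * Dt' (vxi Y) - Jux p * Dt' (vtau Y)"
    and "phi_x Y p = Dx' (vphi Y) - Jut p * Dx' (vxi Y) - Jux p * Dx' (vtau Y)"
  unfolding phi_t_def phi_x_def Dt_def Dx_def pd_characteristic[OF assms(1-3)] Dt'_def Dx'_def
  by (simp_all add: algebra_simps)

text \<open>On the manifold the condition is affine in the free coordinate \<open>u\<^sub>x\<close>: the combination
  \<open>D\<^sub>t + g D\<^sub>x\<close> becomes \<open>along\<close>, because \<open>u\<^sub>t + g u\<^sub>x = f\<close>.\<close>

lemma prolong_equation:
  assumes "partially_differentiable (vxi Y) (Jt p) (Jx p) (Ju p)"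
    and "partially_differentiable (vtau Y) (Jt p) (Jx p) (Ju p)"
    and "partially_differentiable (vphi Y) (Jt p) (Jx p) (Ju p)"
    and eq: "Jut p + Jg p * Jux p = Jf p"
  defines "A \<equiv> \<lambda>h. along h (Jt p) (Jx p) (Ju p) (Jf p) (Jg p)"
  shows "prolong Y (\<lambda>q. Jut q + Jg q * Jux q - Jf q) p =
    A (vphi Y) - Jf p * A (vxi Y) - lift5 (vchi Y) p
    - Jux p * (A (vtau Y) - Jg p * A (vxi Y) - lift5 (veta Y) p)"
proof -
  have "prolong Y (\<lambda>q. Jut q + Jg q * Jux q - Jf q) p =
      phi_t Y p + Jg p * phi_x Y p + Jux p * lift5 (veta Y) p - lift5 (vchi Y) p"
  proof -
    let ?F = "\<lambda>q. Jut q + Jg q * Jux q - Jf q"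
    have "pd Jf Jf_update ?F p = - 1" "pd Jg Jg_update ?F p = Jux p"
      "pd Jut Jut_update ?F p = 1" "pd Jux Jux_update ?F p = Jg p"
      unfolding pd_def by (auto intro!: DERIV_imp_deriv derivative_eq_intros)
    moreover have "pd Jt Jt_update ?F p = 0" "pd Jx Jx_update ?F p = 0" "pd Ju Ju_update ?F p = 0"
      "pd Jft Jft_update ?F p = 0" "pd Jgt Jgt_update ?F p = 0"
      by (simp_all add: pd_def)
    ultimately show ?thesis by (simp add: prolong_def)
  qed
  moreover have "Jut p = Jf p - Jg p * Jux p" using eq by simp
  ultimately show ?thesis
    unfolding phi_t_phi_x_eq[OF assms(1-3)] A_def along_def
    by (simp add: algebra_simps)
qed

lemma prolong_ft:
  assumes "Jft p = 0" "Jgt p = 0"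
  shows "prolong Y Jft p =
    deriv (\<lambda>s. vchi Y s (Jx p) (Ju p) (Jf p) (Jg p)) (Jt p)
    - Jfx p * d_t (vtau Y) (Jt p) (Jx p) (Ju p) - Jfu p * d_t (vphi Y) (Jt p) (Jx p) (Ju p)"
  using assms
  by (simp add: prolong_def chi_t_def Dext_t_def pd_def lift3_def lift5_def d_t_def)

lemma prolong_gt:
  assumes "Jft p = 0" "Jgt p = 0"
  shows "prolong Y Jgt p =
    deriv (\<lambda>s. veta Y s (Jx p) (Ju p) (Jf p) (Jg p)) (Jt p)
    - Jgx p * d_t (vtau Y) (Jt p) (Jx p) (Ju p) - Jgu p * d_t (vphi Y) (Jt p) (Jx p) (Ju p)"
  using assms
  by (simp add: prolong_def eta_t_def Dext_t_def pd_def lift3_def lift5_def d_t_def)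

definition determining_equations ::
  "vfield \<Rightarrow> real \<Rightarrow> real \<Rightarrow> real \<Rightarrow> real \<Rightarrow> real \<Rightarrow> bool" where
  "determining_equations Y t x u f g \<longleftrightarrow>
     vchi Y t x u f g = along (vphi Y) t x u f g - f * along (vxi Y) t x u f g
   \<and> veta Y t x u f g = along (vtau Y) t x u f g - g * along (vxi Y) t x u f g
   \<and> d_t (vtau Y) t x u = 0 \<and> d_t (vphi Y) t x u = 0
   \<and> deriv (\<lambda>s. vchi Y s x u f g) t = 0 \<and> deriv (\<lambda>s. veta Y s x u f g) t = 0"

lemma invariance_iff_determining_equations:
  assumes "open T" "open D" and smooth: "smooth_vfield T D W Y"
  shows "invariance_conditions T D W Y \<longleftrightarrow>
    (\<forall>t\<in>T. \<forall>(x, u)\<in>D. \<forall>(f, g)\<in>W. determining_equations Y t x u f g)"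
proof -
  have pd: "partially_differentiable (vxi Y) t x u" "partially_differentiable (vtau Y) t x u"
    "partially_differentiable (vphi Y) t x u" if "t \<in> T" "(x, u) \<in> D" for t x u
    using smooth assms(1,2) that
    by (auto simp: smooth_vfield_def intro: differentiable_on_imp_partially_differentiable)
  show ?thesis
  proof (intro iffI ballI)
    assume "\<forall>t\<in>T. \<forall>(x, u)\<in>D. \<forall>(f, g)\<in>W. determining_equations Y t x u f g"
    then have *: "determining_equations Y t x u f g"
      if "t \<in> T" "(x, u) \<in> D" "(f, g) \<in> W" for t x u f g using that by blast
    show "invariance_conditions T D W Y"
      unfolding invariance_conditions_def
    proof
      fix p assume p: "p \<in> system_manifold T D W"
      then have "determining_equations Y (Jt p) (Jx p) (Ju p) (Jf p) (Jg p)"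
        by (intro *) (auto simp: system_manifold_def)
      with p pd show "prolong Y (\<lambda>q. Jut q + Jg q * Jux q - Jf q) p = 0 \<and>
          prolong Y Jft p = 0 \<and> prolong Y Jgt p = 0"
        by (auto simp: system_manifold_def prolong_equation prolong_ft prolong_gt
            determining_equations_def lift5_def)
    qed
  next
    fix t xu assume inv: "invariance_conditions T D W Y" and t: "t \<in> T" and xu: "xu \<in> D"
    obtain x u where [simp]: "xu = (x, u)" by (cases xu)
    have "determining_equations Y t x u f g" if fg: "(f, g) \<in> W" for f g
    proof -
      define p where "p ux a b = \<lparr> Jt = t, Jx = x, Ju = u, Jf = f, Jg = g,
        Jut = f - g * ux, Jux = ux, Jutt = 0, Jutx = 0, Juxx = 0,
        Jft = 0, Jfx = a, Jfu = b, Jgt = 0, Jgx = 0, Jgu = 0 \<rparr>" for ux a b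
      have p: "prolong Y (\<lambda>q. Jut q + Jg q * Jux q - Jf q) (p ux a b) = 0"
        "prolong Y Jft (p ux a b) = 0" "prolong Y Jgt (p ux a b) = 0" for ux a b
      proof -
        have "p ux a b \<in> system_manifold T D W"
          using t xu fg by (simp add: system_manifold_def p_def)
        then show "prolong Y (\<lambda>q. Jut q + Jg q * Jux q - Jf q) (p ux a b) = 0"
          "prolong Y Jft (p ux a b) = 0" "prolong Y Jgt (p ux a b) = 0"
          using inv by (auto simp: invariance_conditions_def)
      qed
      \<comment> \<open>compare the coefficients of the free coordinates, by setting them to 0 or 1\<close>
      have 1: "along (vphi Y) t x u f g - f * along (vxi Y) t x u f g - vchi Y t x u f g
          - ux * (along (vtau Y) t x u f g - g * along (vxi Y) t x u f g - veta Y t x u f g) = 0"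
        for ux
        using p(1)[of ux 0 0] pd[OF t, of x u] xu
        by (subst (asm) prolong_equation) (simp_all add: p_def lift5_def)
      have 2: "deriv (\<lambda>s. vchi Y s x u f g) t - a * d_t (vtau Y) t x u - b * d_t (vphi Y) t x u = 0"
        for a b
        using p(2)[of 0 a b] by (subst (asm) prolong_ft) (simp_all add: p_def)
      have 3: "deriv (\<lambda>s. veta Y s x u f g) t = 0"
        using p(3)[of 0 0 0] by (subst (asm) prolong_gt) (simp_all add: p_def)
      show ?thesis
        unfolding determining_equations_def
        using 1[of 0] 1[of 1] 2[of 0 0] 2[of 1 0] 2[of 0 1] 3 by simp
    qed
    then show "case xu of (x, u) \<Rightarrow> \<forall>(f, g)\<in>W. determining_equations Y t x u f g" by auto
  qed
qed

section \<open>Time dependence\<close>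

lemma zero_deriv_on_imp_constant:
  fixes h :: "real \<Rightarrow> real"
  assumes "open T" "connected T" "\<And>t. t \<in> T \<Longrightarrow> (h has_real_derivative 0) (at t)"
    and "s \<in> T" "t \<in> T"
  shows "h s = h t"
  using assms has_derivative_zero_unique_connected[of T h s t]
  by (simp add: has_field_derivative_def lambda_zero)

lemma time_independentD:
  assumes "time_independent T D h" "s \<in> T" "t \<in> T" "(x, u) \<in> D"
  shows "h s x u = h t x u"
proof -
  obtain k where "\<forall>t\<in>T. \<forall>(x, u)\<in>D. h t x u = k x u"
    using assms(1) unfolding time_independent_def by blast
  with assms(2-) have "h s x u = k x u" "h t x u = k x u" by blast+
  then show ?thesis by simp
qed

lemma time_independentI:
  assumes "T \<noteq> {}" "\<And>s t x u. s \<in> T \<Longrightarrow> t \<in> T \<Longrightarrow> (x, u) \<in> D \<Longrightarrow> h s x u = h t x u"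
  shows "time_independent T D h"
proof -
  obtain t0 where "t0 \<in> T" using assms(1) by blast
  then have "\<forall>t\<in>T. \<forall>(x, u)\<in>D. h t x u = h t0 x u" using assms(2) by blast
  then show ?thesis
    unfolding time_independent_def by blast
qed

text \<open>The factor \<open>f\<close> is harmless, since an open set contains enough points with \<open>f \<noteq> 0\<close>: two of them
  with different \<open>g\<close> isolate \<open>a\<close>, two with different \<open>f\<close> isolate \<open>b\<close>.\<close>

lemma affine_vanishing_on_open:
  fixes a b c :: real
  assumes "open W" "W \<noteq> {}"
    and van: "\<And>f g. (f, g) \<in> W \<Longrightarrow> f * (c + g * a + f * b) = 0"
  shows "a = 0" "b = 0" "c = 0"
proof -
  obtain f0 g0 where "(f0, g0) \<in> W" using assms(2) by auto
  then obtain A B where AB: "open A" "open B" "f0 \<in> A" "g0 \<in> B" "A \<times> B \<subseteq> W"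
    using open_prod_elim[OF assms(1)] by (metis mem_Sigma_iff)
  have "infinite (A - {0})"
    using AB(1,3) by (metis finite_imp_not_open empty_iff finite_insert infinite_remove)
  then obtain f1 where f1: "f1 \<in> A" "f1 \<noteq> 0"
    by (metis Diff_iff equals0I finite.emptyI singletonI)
  have "infinite (A - {0, f1})"
    using AB(1,3) by (metis finite_imp_not_open empty_iff finite.emptyI finite_insert Diff_infinite_finite)
  then obtain f2 where f2: "f2 \<in> A" "f2 \<noteq> 0" "f2 \<noteq> f1"
    by (metis Diff_iff equals0I finite.emptyI insertCI)
  have "infinite (B - {g0})"
    using AB(2,4) by (metis finite_imp_not_open empty_iff finite_insert infinite_remove)
  then obtain g1 where g1: "g1 \<in> B" "g1 \<noteq> g0"
    by (metis Diff_iff equals0I finite.emptyI singletonI)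
  have *: "c + g * a + f * b = 0" if "f \<in> A" "g \<in> B" "f \<noteq> 0" for f g
    using van[of f g] AB(5) that by auto
  have "(g1 - g0) * a = 0"
    using *[OF f1(1) g1(1) f1(2)] *[OF f1(1) AB(4) f1(2)] unfolding left_diff_distrib by linarith
  then show a: "a = 0" using g1 by simp
  have "(f2 - f1) * b = 0"
    using *[OF f1(1) AB(4) f1(2)] *[OF f2(1) AB(4) f2(2)] unfolding left_diff_distrib by linarith
  then show b: "b = 0" using f2 by simp
  show "c = 0" using *[OF f1(1) AB(4) f1(2)] a b by simp
qed

text \<open>Only first derivatives of \<open>h\<close> are available, so \<open>h\<^sub>t\<^sub>x = 0\<close> cannot be used. Instead the increment
  \<open>h t\<^sub>1 - h t\<^sub>0\<close>, which equals the slope times \<open>t\<^sub>1 - t\<^sub>0\<close>, is differentiable in \<open>(x, u)\<close> with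
  vanishing partial derivatives; hence the slope is constant.\<close>

lemma affine_in_time_if_partials_time_independent:
  assumes T: "open T" "connected T" "T \<noteq> {}" and D: "open D" "connected D"
    and diff: "(\<lambda>(t, x, u). h t x u) differentiable_on T \<times> D"
    and "time_independent T D (d_t h)" "time_independent T D (d_x h)" "time_independent T D (d_u h)"
  shows "affine_in_time T D h"
proof -
  have ind: "d_t h s x u = d_t h t x u" "d_x h s x u = d_x h t x u" "d_u h s x u = d_u h t x u"
    if "s \<in> T" "t \<in> T" "(x, u) \<in> D" for s t x u
    using assms(7-9)[THEN time_independentD, OF that] by blast+
  have pd: "partially_differentiable h t x u" if "t \<in> T" "(x, u) \<in> D" for t x u
    using differentiable_on_imp_partially_differentiable diff T D that by blast
  obtain t0 where t0: "t0 \<in> T" using T by blast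
  have "infinite (T - {t0})"
    using T t0 by (metis finite_imp_not_open finite_insert infinite_remove)
  then obtain t1 where t1: "t1 \<in> T" "t1 \<noteq> t0"
    by (metis Diff_iff equals0I finite.emptyI singletonI)
  have lin: "h t x u - h t0 x u = d_t h t0 x u * (t - t0)" if t: "t \<in> T" and xu: "(x, u) \<in> D" for t x u
  proof -
    have "((\<lambda>s. h s x u - d_t h t0 x u * s) has_real_derivative 0) (at s)" if s: "s \<in> T" for s
      using pd[OF s xu] ind(1)[OF s t0 xu]
      by (auto simp: partially_differentiable_def intro!: derivative_eq_intros)
    then have "h t x u - d_t h t0 x u * t = h t0 x u - d_t h t0 x u * t0"
      using T t t0 by (intro zero_deriv_on_imp_constant[of T "\<lambda>s. h s x u - d_t h t0 x u * s"]) auto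
    then show ?thesis by (simp add: algebra_simps)
  qed
  have slice: "(\<lambda>(x, u). h t x u) differentiable_on D" if "t \<in> T" for t
  proof -
    have "(\<lambda>p. (\<lambda>(t, x, u). h t x u) (t, p)) differentiable_on D"
    proof (rule differentiable_on_compose[where f = "\<lambda>(t, x, u). h t x u" and g = "Pair t"])
      show "Pair t differentiable_on D"
        by (simp add: differentiable_on_def)
      show "(\<lambda>(t, x, u). h t x u) differentiable_on Pair t ` D"
        using that by (auto intro: differentiable_on_subset[OF diff])
    qed
    then show ?thesis by (simp add: case_prod_unfold)
  qed
  obtain C where C: "h t1 x u - h t0 x u = C" if "(x, u) \<in> D" for x u
  proof -
    have "\<exists>c. \<forall>(x, u)\<in>D. h t1 x u - h t0 x u = c"
    proof (rule zero_partials_imp_constant[OF D])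
      show "(\<lambda>(x, u). h t1 x u - h t0 x u) differentiable_on D"
        using differentiable_on_diff[OF slice[OF t1(1)] slice[OF t0]] by (simp add: case_prod_unfold)
      show "((\<lambda>s. h t1 s u - h t0 s u) has_real_derivative 0) (at x)"
        and "((\<lambda>s. h t1 x s - h t0 x s) has_real_derivative 0) (at u)" if xu: "(x, u) \<in> D" for x u
        using pd[OF t1(1) xu] pd[OF t0 xu] ind[OF t1(1) t0 xu]
        by (auto simp: partially_differentiable_def intro!: derivative_eq_intros)
    qed
    then show ?thesis using that by fast
  qed
  define c where "c = C / (t1 - t0)"
  define a where "a x u = h t0 x u - c * t0" for x u
  have "h t x u = c * t + a x u" if t: "t \<in> T" and xu: "(x, u) \<in> D" for t x u
  proof -
    have "d_t h t0 x u = c"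
      using lin[OF t1(1) xu] C[OF xu] t1(2) by (simp add: c_def field_simps)
    then show ?thesis using lin[OF t xu] by (simp add: a_def algebra_simps)
  qed
  then have "\<forall>t\<in>T. \<forall>(x, u)\<in>D. h t x u = c * t + a x u" by auto
  then show ?thesis unfolding affine_in_time_def by - (rule exI[of _ c], rule exI[of _ a])
qed

lemma time_independent_partials:
  assumes "open T" "open D" "T \<noteq> {}" "time_independent T D h"
  shows "time_independent T D (d_x h)" "time_independent T D (d_u h)"
    and "t \<in> T \<Longrightarrow> (x, u) \<in> D \<Longrightarrow> d_t h t x u = 0"
proof -
  obtain k where "\<forall>t\<in>T. \<forall>(x, u)\<in>D. h t x u = k x u"
    using assms(4) unfolding time_independent_def by blast
  then have k: "h t x u = k x u" if "t \<in> T" "(x, u) \<in> D" for t x u using that by fast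
  have cong: "d_t h t x u = d_t (\<lambda>t. k) t x u" "d_x h t x u = d_x (\<lambda>t. k) t x u"
    "d_u h t x u = d_u (\<lambda>t. k) t x u" if "t \<in> T" "(x, u) \<in> D" for t x u
    using partial_derivatives_cong[OF assms(1,2) that, of h "\<lambda>t. k"] k by simp_all
  have const: "d_x h s x u = d_x h t x u" "d_u h s x u = d_u h t x u"
    if "s \<in> T" "t \<in> T" "(x, u) \<in> D" for s t x u
    using cong(2,3)[OF that(1,3)] cong(2,3)[OF that(2,3)] by (simp_all add: d_x_def d_u_def)
  show "time_independent T D (d_x h)" "time_independent T D (d_u h)"
    by (rule time_independentI[OF assms(3)], rule const; assumption)+
  show "d_t h t x u = 0" if "t \<in> T" "(x, u) \<in> D"
    using cong(1)[OF that] by (simp add: d_t_def)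
qed

lemma affine_in_time_partials:
  assumes "open T" "open D" "T \<noteq> {}" "affine_in_time T D h"
    and diff: "(\<lambda>(t, x, u). h t x u) differentiable_on T \<times> D"
  shows "time_independent T D (d_t h)" "time_independent T D (d_x h)" "time_independent T D (d_u h)"
proof -
  obtain c a where "\<forall>t\<in>T. \<forall>(x, u)\<in>D. h t x u = c * t + a x u"
    using assms(4) unfolding affine_in_time_def by blast
  then have ca: "h t x u = c * t + a x u" if "t \<in> T" "(x, u) \<in> D" for t x u using that by fast
  have pd: "partially_differentiable h t x u" if "t \<in> T" "(x, u) \<in> D" for t x u
    using differentiable_on_imp_partially_differentiable diff assms that by blast
  have "d_t h t x u = c" if "t \<in> T" "(x, u) \<in> D" for t x u
  proof -
    have "deriv (\<lambda>s. c * s + a x u) t = c"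
      by (rule DERIV_imp_deriv) (auto intro!: derivative_eq_intros)
    then show ?thesis
      using partial_derivatives_cong(1)[OF assms(1,2) that, of h "\<lambda>t x u. c * t + a x u"] ca
      by (simp add: d_t_def)
  qed
  then show "time_independent T D (d_t h)"
    unfolding time_independent_def by (intro exI[of _ "\<lambda>x u. c"]) auto
  have shift: "d_x h s x u = d_x h t x u \<and> d_u h s x u = d_u h t x u"
    if st: "s \<in> T" "t \<in> T" and xu: "(x, u) \<in> D" for s t x u
  proof -
    \<comment> \<open>two time slices of \<open>h\<close> differ by a constant, so their spatial derivatives agree\<close>
    define k where "k r y v = h t y v + c * (s - t)" for r y v :: real
    have "d_x (\<lambda>r. h s) s x u = d_x k s x u" "d_u (\<lambda>r. h s) s x u = d_u k s x u"
      by (rule partial_derivatives_cong[OF assms(1,2) st(1) xu],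
          use st ca in \<open>simp add: k_def algebra_simps\<close>)+
    moreover have "d_x k s x u = d_x h t x u"
      unfolding d_x_def[of k] k_def using pd[OF st(2) xu]
      by (intro DERIV_imp_deriv) (auto simp: partially_differentiable_def intro!: derivative_eq_intros)
    moreover have "d_u k s x u = d_u h t x u"
      unfolding d_u_def[of k] k_def using pd[OF st(2) xu]
      by (intro DERIV_imp_deriv) (auto simp: partially_differentiable_def intro!: derivative_eq_intros)
    ultimately show ?thesis by (simp add: d_x_def d_u_def)
  qed
  show "time_independent T D (d_x h)" "time_independent T D (d_u h)"
    by (rule time_independentI[OF assms(3)], use shift in blast)+
qed

section \<open>Infinitesimal generators\<close>

lemma ball_jet_iff:
  "(\<forall>t\<in>T. \<forall>(x, u)\<in>D. \<forall>(f, g)\<in>W. P t x u f g) \<longleftrightarrow>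
    (\<forall>t x u f g. t \<in> T \<longrightarrow> (x, u) \<in> D \<longrightarrow> (f, g) \<in> W \<longrightarrow> P t x u f g)"
  unfolding Ball_def split_paired_All prod.case by blast

text \<open>The formulas for \<open>\<chi>\<close> and \<open>\<eta>\<close> are those of the determining equations with the terms \<open>\<phi>\<^sub>t\<close> and
  \<open>\<tau>\<^sub>t\<close> omitted, which vanish by time independence.\<close>

lemma generator_form_iff_along:
  assumes "open T" "open D" "T \<noteq> {}"
  shows "generator_form T D W Y \<longleftrightarrow>
    time_independent T D (vtau Y) \<and> time_independent T D (vphi Y)
    \<and> (\<forall>t x u f g. t \<in> T \<longrightarrow> (x, u) \<in> D \<longrightarrow> (f, g) \<in> W \<longrightarrow>
        vchi Y t x u f g = along (vphi Y) t x u f g - f * along (vxi Y) t x u f g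
      \<and> veta Y t x u f g = along (vtau Y) t x u f g - g * along (vxi Y) t x u f g)"
  unfolding generator_form_def conj_assoc ball_jet_iff
proof (intro conj_cong refl arg_cong[where f = All] ext imp_cong)
  fix t x u f g assume "time_independent T D (vtau Y)" "time_independent T D (vphi Y)"
    and "t \<in> T" "(x, u) \<in> D"
  then have "d_t (vtau Y) t x u = 0" "d_t (vphi Y) t x u = 0"
    using time_independent_partials(3)[OF assms] by simp_all
  then have
    chi: "g * d_x (vphi Y) t x u - f * g * d_x (vxi Y) t x u - f * d_t (vxi Y) t x u
      + f * d_u (vphi Y) t x u - f\<^sup>2 * d_u (vxi Y) t x u
      = along (vphi Y) t x u f g - f * along (vxi Y) t x u f g"
    and eta: "f * d_u (vtau Y) t x u + g * d_x (vtau Y) t x u - g * d_t (vxi Y) t x u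
      - g\<^sup>2 * d_x (vxi Y) t x u - f * g * d_u (vxi Y) t x u
      = along (vtau Y) t x u f g - g * along (vxi Y) t x u f g"
    unfolding along_def by (simp_all add: algebra_simps power2_eq_square)
  show "(vchi Y t x u f g = g * d_x (vphi Y) t x u - f * g * d_x (vxi Y) t x u
      - f * d_t (vxi Y) t x u + f * d_u (vphi Y) t x u - f\<^sup>2 * d_u (vxi Y) t x u)
      = (vchi Y t x u f g = along (vphi Y) t x u f g - f * along (vxi Y) t x u f g)"
    unfolding chi ..
  show "(veta Y t x u f g = f * d_u (vtau Y) t x u + g * d_x (vtau Y) t x u
      - g * d_t (vxi Y) t x u - g\<^sup>2 * d_x (vxi Y) t x u - f * g * d_u (vxi Y) t x u)
      = (veta Y t x u f g = along (vtau Y) t x u f g - g * along (vxi Y) t x u f g)"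
    unfolding eta ..
qed

lemma invariance_iff_generator_form:
  assumes T: "open T" "connected T" "T \<noteq> {}" and D: "open D" "connected D"
    and W: "open W" "W \<noteq> {}" and smooth: "smooth_vfield T D W Y"
  shows "invariance_conditions T D W Y \<longleftrightarrow>
    generator_form T D W Y \<and> affine_in_time T D (vxi Y)"
proof -
  have diff: "(\<lambda>(t, x, u). vxi Y t x u) differentiable_on T \<times> D"
    using smooth by (simp add: smooth_vfield_def)
  have pd: "partially_differentiable (vtau Y) t x u" "partially_differentiable (vphi Y) t x u"
    if "t \<in> T" "(x, u) \<in> D" for t x u
    using smooth T D that
    by (auto simp: smooth_vfield_def intro: differentiable_on_imp_partially_differentiable)
  have deriv_t: "((\<lambda>s. vchi Y s x u f g) has_real_derivative deriv (\<lambda>s. vchi Y s x u f g) t) (at t)"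
    if "t \<in> T" "(x, u) \<in> D" "(f, g) \<in> W" for t x u f g
  proof -
    have "open (T \<times> D \<times> W)" using T D W by (intro open_Times)
    from has_derivative_deriv_slice[OF _ this, of "\<lambda>(t, (x, u), (f, g)). vchi Y t x u f g"
        "\<lambda>s. (s, (x, u), (f, g))" t]
    show ?thesis using smooth that by (simp add: smooth_vfield_def)
  qed
  note iff = invariance_iff_determining_equations[OF T(1) D(1) smooth]
  show ?thesis
  proof (intro iffI conjI)
    assume "invariance_conditions T D W Y"
    then have det: "determining_equations Y t x u f g"
      if "t \<in> T" "(x, u) \<in> D" "(f, g) \<in> W" for t x u f g
      using iff that by blast
    obtain f0 g0 where W0: "(f0, g0) \<in> W" using W by auto
    have zero: "d_t (vtau Y) t x u = 0" "d_t (vphi Y) t x u = 0"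
      if "t \<in> T" "(x, u) \<in> D" for t x u
      using det[OF that W0] unfolding determining_equations_def by blast+
    have const: "vtau Y s x u = vtau Y t x u" "vphi Y s x u = vphi Y t x u"
      if st: "s \<in> T" "t \<in> T" and xu: "(x, u) \<in> D" for s t x u
      using zero_deriv_on_imp_constant[OF T(1,2) _ st, of "\<lambda>s. vtau Y s x u"]
        zero_deriv_on_imp_constant[OF T(1,2) _ st, of "\<lambda>s. vphi Y s x u"]
        pd[OF _ xu] zero[OF _ xu] by (simp_all add: partially_differentiable_def)
    have ti: "time_independent T D (vtau Y)" "time_independent T D (vphi Y)"
      by (rule time_independentI[OF T(3)], rule const; assumption)+
    have "vchi Y t x u f g = along (vphi Y) t x u f g - f * along (vxi Y) t x u f g"
      "veta Y t x u f g = along (vtau Y) t x u f g - g * along (vxi Y) t x u f g"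
      if "t \<in> T" "(x, u) \<in> D" "(f, g) \<in> W" for t x u f g
      using det[OF that] by (simp_all add: determining_equations_def)
    then show "generator_form T D W Y"
      using ti unfolding generator_form_iff_along[OF T(1) D(1) T(3)] by blast
    have phi: "d_x (vphi Y) s x u = d_x (vphi Y) t x u" "d_u (vphi Y) s x u = d_u (vphi Y) t x u"
      if "s \<in> T" "t \<in> T" "(x, u) \<in> D" for s t x u
      using time_independent_partials(1,2)[OF T(1) D(1) T(3) ti(2), THEN time_independentD, OF that]
      by blast+
    have xi: "d_t (vxi Y) s x u - d_t (vxi Y) t x u = 0 \<and> d_x (vxi Y) s x u - d_x (vxi Y) t x u = 0
        \<and> d_u (vxi Y) s x u - d_u (vxi Y) t x u = 0"
      if st: "s \<in> T" "t \<in> T" and xu: "(x, u) \<in> D" for s t x u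
    proof -
      have "f * ((d_t (vxi Y) s x u - d_t (vxi Y) t x u) + g * (d_x (vxi Y) s x u - d_x (vxi Y) t x u)
          + f * (d_u (vxi Y) s x u - d_u (vxi Y) t x u)) = 0" if fg: "(f, g) \<in> W" for f g
      proof -
        have "vchi Y s x u f g = vchi Y t x u f g"
          using zero_deriv_on_imp_constant[OF T(1,2) _ st, of "\<lambda>s. vchi Y s x u f g"]
            deriv_t[OF _ xu fg] det[OF _ xu fg] by (simp add: determining_equations_def)
        then show ?thesis
          using det[OF st(1) xu fg] det[OF st(2) xu fg] zero(2)[OF st(1) xu] zero(2)[OF st(2) xu]
            phi[OF st xu]
          by (simp add: determining_equations_def along_def algebra_simps)
      qed
      from affine_vanishing_on_open[OF W this] show ?thesis by blast
    qed
    have "time_independent T D (d_t (vxi Y))" "time_independent T D (d_x (vxi Y))"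
      "time_independent T D (d_u (vxi Y))"
      by (rule time_independentI[OF T(3)], use xi[unfolded right_minus_eq] in blast)+
    then show "affine_in_time T D (vxi Y)"
      by (rule affine_in_time_if_partials_time_independent[OF T D diff])
  next
    assume "generator_form T D W Y \<and> affine_in_time T D (vxi Y)"
    then have gen: "generator_form T D W Y" and aff: "affine_in_time T D (vxi Y)" by auto
    have ti: "time_independent T D (vtau Y)" "time_independent T D (vphi Y)"
      using gen unfolding generator_form_def by blast+
    note part = time_independent_partials[OF T(1) D(1) T(3) ti(1)]
      time_independent_partials[OF T(1) D(1) T(3) ti(2)]
      affine_in_time_partials[OF T(1) D(1) T(3) aff diff]
    have formula: "vchi Y t x u f g = along (vphi Y) t x u f g - f * along (vxi Y) t x u f g"
      "veta Y t x u f g = along (vtau Y) t x u f g - g * along (vxi Y) t x u f g"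
      if "t \<in> T" "(x, u) \<in> D" "(f, g) \<in> W" for t x u f g
      using gen that unfolding generator_form_iff_along[OF T(1) D(1) T(3)] by blast+
    have along_const: "along (vxi Y) s x u f g = along (vxi Y) t x u f g"
      "along (vtau Y) s x u f g = along (vtau Y) t x u f g"
      "along (vphi Y) s x u f g = along (vphi Y) t x u f g"
      if "s \<in> T" "t \<in> T" "(x, u) \<in> D" for s t x u f g
    proof -
      have "d_t (vxi Y) s x u = d_t (vxi Y) t x u" "d_x (vxi Y) s x u = d_x (vxi Y) t x u"
        "d_u (vxi Y) s x u = d_u (vxi Y) t x u" "d_x (vtau Y) s x u = d_x (vtau Y) t x u"
        "d_u (vtau Y) s x u = d_u (vtau Y) t x u" "d_x (vphi Y) s x u = d_x (vphi Y) t x u"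
        "d_u (vphi Y) s x u = d_u (vphi Y) t x u"
        using part(1,2,4,5,7-9)[THEN time_independentD, OF that] by blast+
      then show "along (vxi Y) s x u f g = along (vxi Y) t x u f g"
        "along (vtau Y) s x u f g = along (vtau Y) t x u f g"
        "along (vphi Y) s x u f g = along (vphi Y) t x u f g"
        using part(3,6) that by (simp_all add: along_def)
    qed
    have "determining_equations Y t x u f g"
      if t: "t \<in> T" and xu: "(x, u) \<in> D" and fg: "(f, g) \<in> W" for t x u f g
    proof -
      have ev: "eventually (\<lambda>s. s \<in> T) (nhds t)"
        using T t by (simp add: eventually_nhds_in_open)
      have const: "vchi Y s x u f g = vchi Y t x u f g" "veta Y s x u f g = veta Y t x u f g"
        if s: "s \<in> T" for s
        using formula[OF s xu fg] formula[OF t xu fg] along_const[OF s t xu] by simp_all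
      have "deriv (\<lambda>s. vchi Y s x u f g) t = deriv (\<lambda>s. vchi Y t x u f g) t"
        by (intro deriv_cong_ev refl eventually_mono[OF ev] const)
      moreover have "deriv (\<lambda>s. veta Y s x u f g) t = deriv (\<lambda>s. veta Y t x u f g) t"
        by (intro deriv_cong_ev refl eventually_mono[OF ev] const)
      ultimately show ?thesis
        using formula[OF t xu fg] part(3,6)[OF t xu] by (simp add: determining_equations_def)
    qed
    then show "invariance_conditions T D W Y" unfolding iff by blast
  qed
qed

text \<open>These identities hold for all functions \<open>\<xi>, \<tau>, \<phi>\<close>, differentiable or not, since both sides
  use the same total function \<open>deriv\<close>.\<close>

lemma vadd_Y1_Y2_Y3:
  fixes \<xi> \<tau> \<phi>
  defines "Z \<equiv> Y1 \<xi> \<oplus>\<^sub>v Y2 \<tau> \<oplus>\<^sub>v Y3 \<phi>"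
  shows "vxi Z = \<xi>" "vtau Z = (\<lambda>t. \<tau>)" "vphi Z = (\<lambda>t. \<phi>)"
    and "vchi Z t x u f g = along (vphi Z) t x u f g - f * along (vxi Z) t x u f g"
    and "veta Z t x u f g = along (vtau Z) t x u f g - g * along (vxi Z) t x u f g"
  by (simp_all add: Z_def vadd_def Y1_def Y2_def Y3_def along_def d_t_def d_x_def d_u_def algebra_simps)

lemma generator_form_iff_decomposition:
  assumes T: "open T" "T \<noteq> {}" and D: "open D"
  shows "generator_form T D W Y \<longleftrightarrow>
    (\<exists>\<xi> \<tau> \<phi>. vfield_eq_on T D W Y (Y1 \<xi> \<oplus>\<^sub>v Y2 \<tau> \<oplus>\<^sub>v Y3 \<phi>))"
proof -
  have along_cong: "along h t x u f g = along k t x u f g"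
    if "t \<in> T" "(x, u) \<in> D" "\<And>t x u. t \<in> T \<Longrightarrow> (x, u) \<in> D \<Longrightarrow> h t x u = k t x u"
    for h k t x u f g
    using partial_derivatives_cong[OF T(1) D that(1,2), of h k] that(3) by (simp add: along_def)
  note gen_iff = generator_form_iff_along[OF T(1) D T(2)]
  show ?thesis
  proof
    assume gen: "generator_form T D W Y"
    then have "time_independent T D (vtau Y)" "time_independent T D (vphi Y)"
      unfolding generator_form_def by blast+
    then obtain \<tau> \<phi> where
      \<tau>: "\<forall>t\<in>T. \<forall>(x, u)\<in>D. vtau Y t x u = \<tau> x u" and
      \<phi>: "\<forall>t\<in>T. \<forall>(x, u)\<in>D. vphi Y t x u = \<phi> x u"
      unfolding time_independent_def by (elim exE)
    have k: "vtau Y t x u = \<tau> x u" "vphi Y t x u = \<phi> x u" if "t \<in> T" "(x, u) \<in> D" for t x u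
      using \<tau> \<phi> that by blast+
    define Z where "Z = Y1 (vxi Y) \<oplus>\<^sub>v Y2 \<tau> \<oplus>\<^sub>v Y3 \<phi>"
    note Z = vadd_Y1_Y2_Y3[of "vxi Y" \<tau> \<phi>, folded Z_def]
    have "vchi Y t x u f g = vchi Z t x u f g \<and> veta Y t x u f g = veta Z t x u f g"
      if "t \<in> T" "(x, u) \<in> D" "(f, g) \<in> W" for t x u f g
    proof -
      have "vchi Y t x u f g = along (vphi Y) t x u f g - f * along (vxi Y) t x u f g"
        "veta Y t x u f g = along (vtau Y) t x u f g - g * along (vxi Y) t x u f g"
        using gen that unfolding gen_iff by blast+
      moreover have "along (vphi Y) t x u f g = along (vphi Z) t x u f g"
        "along (vtau Y) t x u f g = along (vtau Z) t x u f g"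
        by (rule along_cong[OF that(1,2)], simp add: k Z)+
      ultimately show ?thesis by (simp add: Z(1,4,5))
    qed
    moreover have "vxi Y t x u = vxi Z t x u \<and> vtau Y t x u = vtau Z t x u \<and> vphi Y t x u = vphi Z t x u"
      if "t \<in> T" "(x, u) \<in> D" for t x u using k that by (simp add: Z)
    ultimately have "vfield_eq_on T D W Y Z"
      unfolding vfield_eq_on_def by blast
    then show "\<exists>\<xi> \<tau> \<phi>. vfield_eq_on T D W Y (Y1 \<xi> \<oplus>\<^sub>v Y2 \<tau> \<oplus>\<^sub>v Y3 \<phi>)"
      unfolding Z_def by blast
  next
    assume "\<exists>\<xi> \<tau> \<phi>. vfield_eq_on T D W Y (Y1 \<xi> \<oplus>\<^sub>v Y2 \<tau> \<oplus>\<^sub>v Y3 \<phi>)"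
    then obtain \<xi> \<tau> \<phi> Z where Z_def: "Z = Y1 \<xi> \<oplus>\<^sub>v Y2 \<tau> \<oplus>\<^sub>v Y3 \<phi>"
      and eq: "vfield_eq_on T D W Y Z" by blast
    note Z = vadd_Y1_Y2_Y3[of \<xi> \<tau> \<phi>, folded Z_def]
    have k: "vtau Y t x u = vtau Z t x u" "vphi Y t x u = vphi Z t x u" "vxi Y t x u = vxi Z t x u"
      if "t \<in> T" "(x, u) \<in> D" for t x u
      using eq that unfolding vfield_eq_on_def by fast+
    have "time_independent T D (vtau Y)" "time_independent T D (vphi Y)"
      by (rule time_independentI[OF T(2)], simp add: k Z(2,3))+
    moreover have "vchi Y t x u f g = along (vphi Y) t x u f g - f * along (vxi Y) t x u f g
        \<and> veta Y t x u f g = along (vtau Y) t x u f g - g * along (vxi Y) t x u f g"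
      if "t \<in> T" "(x, u) \<in> D" "(f, g) \<in> W" for t x u f g
    proof -
      have "vchi Y t x u f g = vchi Z t x u f g" "veta Y t x u f g = veta Z t x u f g"
        using eq that unfolding vfield_eq_on_def by fast+
      moreover have "along (vphi Y) t x u f g = along (vphi Z) t x u f g"
        "along (vtau Y) t x u f g = along (vtau Z) t x u f g"
        "along (vxi Y) t x u f g = along (vxi Z) t x u f g"
        by (rule along_cong[OF that(1,2)], simp add: k)+
      ultimately show ?thesis by (simp add: Z(4,5))
    qed
    ultimately show "generator_form T D W Y" unfolding gen_iff by blast
  qed
qed

theorem mainTheorem2:
  fixes T :: "real set" and D W :: "(real \<times> real) set" and Y :: vfield
  assumes "open T" "connected T" "T \<noteq> {}"
    and "open D" "connected D" "D \<noteq> {}"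
    and "open W" "W \<noteq> {}"
    and "smooth_vfield T D W Y"
  shows "(invariance_conditions T D W Y \<longleftrightarrow>
            generator_form T D W Y \<and> affine_in_time T D (vxi Y))
       \<and> (generator_form T D W Y \<longleftrightarrow>
            (\<exists>\<xi> \<tau> \<phi>. vfield_eq_on T D W Y (Y1 \<xi> \<oplus>\<^sub>v Y2 \<tau> \<oplus>\<^sub>v Y3 \<phi>)))"
  using invariance_iff_generator_form[of T D W Y] generator_form_iff_decomposition[of T D W Y] assms
  by blast

end
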